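(* Let $U$ be a speared open subset of $\mathbb{H}$. For every $x_0\in U$, there exists a slice domain $\Lambda_{x_0}\subseteq U$ including $x_0$.
   Context: $\mathbb{H}$ is the algebra of quaternions (Euclidean topology), $\mathbb{S}=\{w\in\mathbb{H}: w^2=-1\}$. For $I\in\mathbb{S}$: $\mathbb{C}_I=\mathbb{R}+\mathbb{R}I$, $\mathbb{C}_I^{\geqslant}=\{\alpha+\beta I:\alpha,\beta\in\mathbb{R},\beta\ge0\}$. For $T\subseteq\mathbb{H}$: $T_I=T\cap\mathbb{C}_I$, $T_I^{\geqslant}=T\cap\mathbb{C}_I^{\geqslant}$. A domain is a nonempty connected open subset of $\mathbb{H}$. A domain $\Omega$ is a slice domain if $\Omega\cap\mathbb{R}\neq\emptyset$ and $\Omega_J$ is connected for all $J\in\mathbb{S}$. An open $U\subseteq\mathbb{H}$ is speared if, for all $I\in\mathbb{S}$, each connected component of $U_I^{\geqslant}$ includes a real point. *)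

theory Defs
  imports "HOL-Analysis.Analysis"
begin

section \<open>The quaternions as a real normed division algebra and Euclidean space\<close>

datatype quat = Quat (qre: real) (qi: real) (qj: real) (qk: real)

text \<open>\<open>Quat a b c d\<close> stands for \<open>a + b i + c j + d k\<close>, where
  \<open>i\<^sup>2 = j\<^sup>2 = k\<^sup>2 = -1\<close>, \<open>i j = k\<close>, \<open>j k = i\<close> and \<open>k i = j\<close>.\<close>

lemma quat_eq_iff: "x = y \<longleftrightarrow> qre x = qre y \<and> qi x = qi y \<and> qj x = qj y \<and> qk x = qk y"
  by (cases x; cases y) simp

instantiation quat :: ab_group_add
begin

definition zero_quat_def: "0 = Quat 0 0 0 0"
definition plus_quat_def:
  "x + y = Quat (qre x + qre y) (qi x + qi y) (qj x + qj y) (qk x + qk y)"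
definition uminus_quat_def:
  "- x = Quat (- qre x) (- qi x) (- qj x) (- qk x)"
definition minus_quat_def:
  "x - y = Quat (qre x - qre y) (qi x - qi y) (qj x - qj y) (qk x - qk y)"

instance
  by standard
    (simp_all add: quat_eq_iff zero_quat_def plus_quat_def uminus_quat_def minus_quat_def)

end

lemma quat_add_simps [simp]:
  "qre 0 = 0" "qi 0 = 0" "qj 0 = 0" "qk 0 = 0"
  "qre (x + y) = qre x + qre y" "qi (x + y) = qi x + qi y"
  "qj (x + y) = qj x + qj y" "qk (x + y) = qk x + qk y"
  "qre (- x) = - qre x" "qi (- x) = - qi x" "qj (- x) = - qj x" "qk (- x) = - qk x"
  "qre (x - y) = qre x - qre y" "qi (x - y) = qi x - qi y"
  "qj (x - y) = qj x - qj y" "qk (x - y) = qk x - qk y"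
  by (simp_all add: zero_quat_def plus_quat_def uminus_quat_def minus_quat_def)

instantiation quat :: ring_1
begin

definition one_quat_def: "1 = Quat 1 0 0 0"
definition times_quat_def:
  "x * y = Quat
    (qre x * qre y - qi x * qi y - qj x * qj y - qk x * qk y)
    (qre x * qi y + qi x * qre y + qj x * qk y - qk x * qj y)
    (qre x * qj y - qi x * qk y + qj x * qre y + qk x * qi y)
    (qre x * qk y + qi x * qj y - qj x * qi y + qk x * qre y)"

instance
  by standard (simp_all add: quat_eq_iff one_quat_def times_quat_def algebra_simps)

end

lemma quat_mult_simps [simp]:
  "qre 1 = 1" "qi 1 = 0" "qj 1 = 0" "qk 1 = 0"
  "qre (x * y) = qre x * qre y - qi x * qi y - qj x * qj y - qk x * qk y"
  "qi (x * y) = qre x * qi y + qi x * qre y + qj x * qk y - qk x * qj y"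
  "qj (x * y) = qre x * qj y - qi x * qk y + qj x * qre y + qk x * qi y"
  "qk (x * y) = qre x * qk y + qi x * qj y - qj x * qi y + qk x * qre y"
  by (simp_all add: one_quat_def times_quat_def)

instantiation quat :: real_algebra_1
begin

definition scaleR_quat_def:
  "scaleR r x = Quat (r * qre x) (r * qi x) (r * qj x) (r * qk x)"

instance
  by standard (simp_all add: quat_eq_iff scaleR_quat_def algebra_simps)

end

lemma quat_scaleR_simps [simp]:
  "qre (r *\<^sub>R x) = r * qre x" "qi (r *\<^sub>R x) = r * qi x"
  "qj (r *\<^sub>R x) = r * qj x" "qk (r *\<^sub>R x) = r * qk x"
  by (simp_all add: scaleR_quat_def)

lemma quat_of_real_simps [simp]:
  "qre (of_real r) = r" "qi (of_real r) = 0" "qj (of_real r) = 0" "qk (of_real r) = 0"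
  by (simp_all add: of_real_def)

instantiation quat :: real_inner
begin

definition inner_quat_def:
  "inner x y = qre x * qre y + qi x * qi y + qj x * qj y + qk x * qk y"
definition norm_quat_def:
  "norm x = sqrt ((qre x)\<^sup>2 + (qi x)\<^sup>2 + (qj x)\<^sup>2 + (qk x)\<^sup>2)"
definition sgn_quat_def: "sgn (x::quat) = x /\<^sub>R norm x"
definition dist_quat_def: "dist x y = norm (x - y :: quat)"
definition uniformity_quat_def [code del]:
  "(uniformity :: (quat \<times> quat) filter) = (INF e\<in>{0<..}. principal {(x, y). dist x y < e})"
definition open_quat_def [code del]:
  "open (U :: quat set) \<longleftrightarrow> (\<forall>x\<in>U. \<forall>\<^sub>F (x', y) in uniformity. x' = x \<longrightarrow> y \<in> U)"

instance
proof
  fix x y z :: quat and r :: real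
  show "inner x x = 0 \<longleftrightarrow> x = 0"
    by (simp add: inner_quat_def quat_eq_iff add_nonneg_eq_0_iff)
  show "inner x y = inner y x"
    by (simp add: inner_quat_def mult.commute)
  show "inner (x + y) z = inner x z + inner y z"
    by (simp add: inner_quat_def distrib_right)
  show "inner (r *\<^sub>R x) y = r * inner x y"
    by (simp add: inner_quat_def distrib_left mult.assoc)
  show "0 \<le> inner x x"
    by (simp add: inner_quat_def)
  show "norm x = sqrt (inner x x)"
    by (simp add: inner_quat_def norm_quat_def power2_eq_square)
qed (rule sgn_quat_def dist_quat_def uniformity_quat_def open_quat_def)+

end

instantiation quat :: real_normed_div_algebra
begin

definition inverse_quat_def:
  "inverse x = Quat (qre x) (- qi x) (- qj x) (- qk x) /\<^sub>R (norm x)\<^sup>2"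
definition divide_quat_def: "x div y = x * inverse (y::quat)"

instance
proof
  fix x y :: quat
  have n: "(norm z)\<^sup>2 = (qre z)\<^sup>2 + (qi z)\<^sup>2 + (qj z)\<^sup>2 + (qk z)\<^sup>2" for z :: quat
    by (simp add: norm_quat_def)
  have c: "z * Quat (qre z) (- qi z) (- qj z) (- qk z) = of_real ((norm z)\<^sup>2)"
    "Quat (qre z) (- qi z) (- qj z) (- qk z) * z = of_real ((norm z)\<^sup>2)" for z
    by (simp_all add: quat_eq_iff n) (simp_all add: power2_eq_square)
  show "norm (x * y) = norm x * norm y"
    unfolding norm_quat_def real_sqrt_mult [symmetric]
    by (simp add: power2_eq_square algebra_simps)
  show "x div y = x * inverse y"
    by (rule divide_quat_def)
  show "inverse (0::quat) = 0"
    by (simp add: inverse_quat_def quat_eq_iff)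
  assume "x \<noteq> 0"
  then show "inverse x * x = 1" "x * inverse x = 1"
    by (simp_all add: inverse_quat_def c del: of_real_power) (simp_all add: of_real_def)
qed

end

instantiation quat :: euclidean_space
begin

definition Basis_quat_def:
  "Basis = {Quat 1 0 0 0, Quat 0 1 0 0, Quat 0 0 1 0, Quat 0 0 0 1}"

instance
proof
  fix u v x :: quat
  show "(Basis :: quat set) \<noteq> {}" "finite (Basis :: quat set)"
    by (simp_all add: Basis_quat_def)
  show "inner u v = (if u = v then 1 else 0)" if "u \<in> Basis" "v \<in> Basis"
    using that unfolding Basis_quat_def
    by (elim insertE emptyE) (simp_all add: inner_quat_def)
  show "(\<forall>u\<in>Basis. inner x u = 0) \<longleftrightarrow> x = 0"
    by (simp add: Basis_quat_def inner_quat_def quat_eq_iff [of x 0])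
qed

end

section \<open>Slices, slice domains and speared sets\<close>

definition imag_units :: "quat set" where
  "imag_units = {w. w\<^sup>2 = - 1}"

definition slice_plane :: "quat \<Rightarrow> quat set" where
  "slice_plane I = {of_real a + of_real b * I | a b. True}"

definition slice_halfplane :: "quat \<Rightarrow> quat set" where
  "slice_halfplane I = {of_real a + of_real b * I | a b. 0 \<le> b}"

definition quat_domain :: "quat set \<Rightarrow> bool" where
  "quat_domain D \<longleftrightarrow> D \<noteq> {} \<and> connected D \<and> open D"

text \<open>In the following, \<open>\<real>\<close> denotes the image of the real numbers in \<^typ>\<open>quat\<close>.\<close>

definition slice_domain :: "quat set \<Rightarrow> bool" where
  "slice_domain D \<longleftrightarrow> quat_domain D \<and> D \<inter> \<real> \<noteq> {} \<and>
    (\<forall>J\<in>imag_units. connected (D \<inter> slice_plane J))"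

definition speared :: "quat set \<Rightarrow> bool" where
  "speared U \<longleftrightarrow> open U \<and>
    (\<forall>I\<in>imag_units. \<forall>C\<in>components (U \<inter> slice_halfplane I). C \<inter> \<real> \<noteq> {})"

end

theory Submission
  imports Defs
begin

text \<open>Join \<open>x\<^sub>0\<close> to the real axis inside a half-slice of \<open>U\<close> by a path meeting \<open>\<real>\<close> only at its
  end \<open>r\<close>, stop it inside a ball \<open>B(r, \<rho>) \<subseteq> U\<close>, and let \<open>K\<close> be the compact trace. Then
  \<open>\<Lambda> = B(r, \<rho>) \<union> (\<Union>z\<in>K. B(z, m \<bar>Im z\<bar>))\<close> works for small \<open>m\<close>. The point is that the radii are
  proportional to the distance to \<open>\<real>\<close>: the distance from \<open>z = \<alpha> + \<beta> I\<close> to the plane of \<open>J\<close> is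
  \<open>\<bar>\<beta>\<bar>\<close> times that of \<open>I\<close>, so that plane meets either all of the balls centred on \<open>K\<close>, each in a
  disc containing the projection of its centre, or none of them.\<close>

section \<open>Imaginary units, slice planes and half-planes\<close>

lemma imag_units_qre_norm:
  assumes "J \<in> imag_units"
  shows "qre J = 0" "norm J = 1"
proof -
  have eq: "J * J = - 1"
    using assms by (simp add: imag_units_def power2_eq_square)
  have re: "qre J * qre J - qi J * qi J - qj J * qj J - qk J * qk J = - 1"
    and im: "qre J * qi J = 0" "qre J * qj J = 0" "qre J * qk J = 0"
    using eq unfolding quat_eq_iff by auto
  show *: "qre J = 0"
  \<comment> \<open>The imaginary parts of \<open>J * J\<close> vanish, so a nonzero real part would
    make \<open>J\<close> real, and no real number squares to -1.\<close>
  proof (rule ccontr)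
    assume "qre J \<noteq> 0"
    then have "qre J * qre J = - 1"
      using re im by simp
    then show False
      using zero_le_square [of "qre J"] by linarith
  qed
  show "norm J = 1"
    using re by (simp add: norm_quat_def power2_eq_square *)
qed

lemma slice_plane_span: "slice_plane J = span {1, J}"
  unfolding slice_plane_def span_insert span_singleton
  by (fastforce simp: of_real_def algebra_simps)

lemma subspace_slice_plane: "subspace (slice_plane J)"
  by (simp add: slice_plane_span)

lemma slice_halfplane_subset: "slice_halfplane J \<subseteq> slice_plane J"
  by (auto simp: slice_halfplane_def slice_plane_def)

text \<open>Convexity later makes relatively open subsets of a half-plane locally path
  connected.\<close>

lemma convex_slice_halfplane: "convex (slice_halfplane J)"
proof (rule convexI)
  fix x y :: quat and u v :: real
  assume "x \<in> slice_halfplane J" "y \<in> slice_halfplane J" and uv: "0 \<le> u" "0 \<le> v"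
  then obtain a b c d where "x = of_real a + of_real b * J" "y = of_real c + of_real d * J"
    and bd: "0 \<le> b" "0 \<le> d"
    by (auto simp: slice_halfplane_def)
  then have "u *\<^sub>R x + v *\<^sub>R y = of_real (u * a + v * c) + of_real (u * b + v * d) * J"
    by (simp add: of_real_def algebra_simps)
  moreover have "0 \<le> u * b + v * d"
    using uv bd by simp
  ultimately show "u *\<^sub>R x + v *\<^sub>R y \<in> slice_halfplane J"
    unfolding slice_halfplane_def by blast
qed

text \<open>Normalising the nonzero imaginary part of \<open>x\<close> gives the unit
  \<open>I\<close>; the coefficient of \<open>I\<close> is then a norm, hence positive.\<close>

lemma quat_in_slice_halfplane:
  assumes "x \<notin> \<real>"
  obtains I where "I \<in> imag_units" "x \<in> slice_halfplane I"
proof -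
  define b where "b = norm (x - of_real (qre x))"
  define I where "I = (x - of_real (qre x)) /\<^sub>R b"
  have "x \<noteq> of_real (qre x)"
    using assms by (metis Reals_of_real)
  then have b: "b > 0"
    by (simp add: b_def)
  have b2: "(qi x)\<^sup>2 + (qj x)\<^sup>2 + (qk x)\<^sup>2 = b\<^sup>2"
    by (simp add: b_def norm_quat_def)
  have "I\<^sup>2 = - 1"
    using b b2 by (simp add: I_def power2_eq_square quat_eq_iff field_simps)
  then have "I \<in> imag_units"
    by (simp add: imag_units_def)
  moreover have "x = of_real (qre x) + of_real b * I"
    using b by (simp add: I_def scaleR_conv_of_real [symmetric])
  then have "x \<in> slice_halfplane I"
    using b unfolding slice_halfplane_def by (metis (mono_tags, lifting) less_imp_le mem_Collect_eq)
  ultimately show thesis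
    by (rule that)
qed

section \<open>Orthogonal projection onto a slice plane\<close>

text \<open>For an imaginary unit \<open>J\<close> this is the orthogonal projection onto its plane,
  since \<open>1\<close> and \<open>J\<close> are then orthonormal.\<close>

definition slice_proj :: "quat \<Rightarrow> quat \<Rightarrow> quat" where
  "slice_proj J q = (q \<bullet> 1) *\<^sub>R 1 + (q \<bullet> J) *\<^sub>R J"

lemma linear_slice_proj: "linear (slice_proj J)"
  by (rule linearI) (simp_all add: slice_proj_def algebra_simps inner_left_distrib)

lemma slice_proj_in: "slice_proj J q \<in> slice_plane J"
  unfolding slice_plane_span slice_proj_def
  by (intro span_add span_scale span_base) auto

context
  fixes J :: quat
  assumes J: "J \<in> imag_units"
begin

lemma inner_one_imag_unit: "1 \<bullet> J = 0" "J \<bullet> 1 = 0" "J \<bullet> J = 1" "1 \<bullet> (1::quat) = 1"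
  using imag_units_qre_norm [OF J] by (simp_all add: inner_quat_def norm_eq_sqrt_inner)

lemma slice_proj_of_real: "slice_proj J (of_real r) = of_real r"
  by (simp add: slice_proj_def of_real_def inner_one_imag_unit)

lemma slice_proj_pythagoras:
  assumes "p \<in> slice_plane J"
  shows "(norm (q - p))\<^sup>2 = (norm (q - slice_proj J q))\<^sup>2 + (norm (slice_proj J q - p))\<^sup>2"
proof -
  have "orthogonal (q - slice_proj J q) (slice_proj J q - p)"
  proof (rule orthogonal_to_span [of _ "{1, J}"])
    show "slice_proj J q - p \<in> span {1, J}"
      using subspace_diff [OF subspace_slice_plane slice_proj_in assms]
      by (simp add: slice_plane_span)
    show "orthogonal (q - slice_proj J q) y" if "y \<in> {1, J}" for y
      using that
      by (auto simp: orthogonal_def slice_proj_def inner_diff_left inner_add_left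
          inner_one_imag_unit)
  qed
  from norm_add_Pythagorean [OF this] show ?thesis
    by simp
qed

lemma dist_slice_proj_le:
  assumes "p \<in> slice_plane J"
  shows "dist q (slice_proj J q) \<le> dist q p" "dist (slice_proj J q) p \<le> dist q p"
  using slice_proj_pythagoras [OF assms, of q] by (auto simp: dist_norm intro: power2_le_imp_le)

text \<open>The projection is linear and fixes the reals, so it displaces \<open>a + b I\<close> by
  \<open>b\<close> times its displacement of \<open>I\<close>. The second factor does not depend on
  \<open>z\<close>.\<close>

lemma dist_slice_proj_slice:
  assumes I: "I \<in> imag_units" and z: "z \<in> slice_plane I"
  shows "dist z (slice_proj J z) = norm (z - of_real (qre z)) * dist I (slice_proj J I)"
proof -
  obtain a b where ab: "z = of_real a + of_real b * I"
    using z by (auto simp: slice_plane_def)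
  then have zs: "z = of_real a + b *\<^sub>R I"
    by (simp add: scaleR_conv_of_real)
  have "slice_proj J z = of_real a + b *\<^sub>R slice_proj J I"
    by (simp add: zs linear_add [OF linear_slice_proj] linear_scale [OF linear_slice_proj]
        slice_proj_of_real)
  then have "dist z (slice_proj J z) = \<bar>b\<bar> * dist I (slice_proj J I)"
    by (simp add: zs dist_norm flip: scaleR_diff_right)
  moreover have "qre z = a"
    using imag_units_qre_norm(1) [OF I] by (simp add: zs)
  then have "z - of_real (qre z) = b *\<^sub>R I"
    using zs by simp
  then have "norm (z - of_real (qre z)) = \<bar>b\<bar>"
    using imag_units_qre_norm(2) [OF I] by simp
  ultimately show ?thesis
    by simp
qed

end

section \<open>Slice domains built from balls\<close>

text \<open>The connected set \<open>f\<close> K\<open>meets every\<close>D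
  z\<open>, so the sets\<close>f \<open>K \<union> D z\<close> are connected and share it.\<close>

lemma connected_UN_section:
  fixes f :: "'a::topological_space \<Rightarrow> 'b::topological_space"
  assumes "connected K" "continuous_on K f"
    and D: "\<And>z. z \<in> K \<Longrightarrow> connected (D z)" "\<And>z. z \<in> K \<Longrightarrow> f z \<in> D z"
  shows "connected (\<Union>z\<in>K. D z)"
proof (cases "K = {}")
  case False
  have "(\<Union>z\<in>K. D z) = \<Union>((\<lambda>z. f ` K \<union> D z) ` K)"
    using D(2) by blast
  moreover have "connected (\<Union>((\<lambda>z. f ` K \<union> D z) ` K))"
  proof (rule connected_Union)
    show "connected S" if "S \<in> (\<lambda>z. f ` K \<union> D z) ` K" for S
      using that D assms(1,2) by (auto intro!: connected_Un connected_continuous_image)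
    show "\<Inter>((\<lambda>z. f ` K \<union> D z) ` K) \<noteq> {}"
      using False by blast
  qed
  ultimately show ?thesis
    by simp
qed simp

lemma slice_domain_ball_of_real:
  assumes "0 < \<rho>"
  shows "slice_domain (ball (of_real r) \<rho>)"
proof -
  have "of_real r \<in> ball (of_real r :: quat) \<rho> \<inter> \<real>"
    using assms by simp
  moreover have "connected (ball (of_real r) \<rho> \<inter> slice_plane J)" for J
    by (intro convex_connected convex_Int convex_ball subspace_imp_convex subspace_slice_plane)
  ultimately show ?thesis
    unfolding slice_domain_def quat_domain_def
    by (metis Int_iff connected_ball empty_iff open_ball)
qed

text \<open>The ball about the real point is already a slice domain. The point \<open>w\<close> of
  \<open>K\<close> inside that ball glues the tube to it, in the whole space and, after projection,
  in each slice that the tube meets.\<close>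

lemma slice_domain_ball_tube:
  assumes I: "I \<in> imag_units" and K: "connected K" "K \<subseteq> slice_plane I" "K \<inter> \<real> = {}"
    and w: "w \<in> K" "w \<in> ball (of_real r) \<rho>" and m: "0 < m"
  shows "slice_domain (ball (of_real r) \<rho> \<union> (\<Union>z\<in>K. ball z (m * norm (z - of_real (qre z)))))"
    (is "slice_domain (?B \<union> (\<Union>z\<in>K. ?D z))")
proof -
  have "0 < \<rho>"
    using w(2) by (metis ball_eq_empty empty_iff not_le)
  then have B: "slice_domain ?B"
    by (rule slice_domain_ball_of_real)
  have pos: "0 < norm (z - of_real (qre z))" if "z \<in> K" for z
    using K(3) that by (metis Reals_of_real disjoint_iff right_minus_eq zero_less_norm_iff)
  then have D: "z \<in> ?D z" if "z \<in> K" for z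
    using that m by simp
  have "connected (\<Union>z\<in>K. ?D z)"
    by (rule connected_UN_section [where f = "\<lambda>z. z"]) (use K D in auto)
  then have conn: "connected (?B \<union> (\<Union>z\<in>K. ?D z))"
    using w D by (intro connected_Un connected_ball) blast+
  have slices: "connected ((?B \<union> (\<Union>z\<in>K. ?D z)) \<inter> slice_plane J)" if J: "J \<in> imag_units" for J
  \<comment> \<open>Radius and distance to the plane of \<open>J\<close> both scale with
    \<open>norm (z - of_real (qre z))\<close>, so this test decides for all \<open>z\<close> in
    \<open>K\<close> at once.\<close>
  proof (cases "dist I (slice_proj J I) < m")
    case True
    have BJ: "connected (?B \<inter> slice_plane J)"
      using B J by (simp add: slice_domain_def)
    have DJ: "slice_proj J z \<in> ?D z \<inter> slice_plane J" if "z \<in> K" for z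
      using True pos [OF that] K(2) that
      by (auto simp: slice_proj_in dist_slice_proj_slice [OF J I subsetD])
    have "connected (\<Union>z\<in>K. ?D z \<inter> slice_plane J)"
    proof (rule connected_UN_section [OF K(1) _ _ DJ])
      show "continuous_on K (slice_proj J)"
        by (rule linear_continuous_on) (simp add: linear_slice_proj linear_linear)
      show "connected (?D z \<inter> slice_plane J)" for z
        by (intro convex_connected convex_Int convex_ball subspace_imp_convex subspace_slice_plane)
    qed
    \<comment> \<open>As the centre lies in the plane, projecting \<open>w\<close> does not move it
      farther from the centre.\<close>
    moreover have "of_real r \<in> slice_plane J"
      using slice_proj_in [of J "of_real r"] by (simp add: slice_proj_of_real [OF J])
    then have "slice_proj J w \<in> ?B \<inter> slice_plane J"
      using dist_slice_proj_le(2) [OF J, of "of_real r" w] w(2)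
      by (simp add: slice_proj_in dist_commute)
    ultimately have "connected ((?B \<inter> slice_plane J) \<union> (\<Union>z\<in>K. ?D z \<inter> slice_plane J))"
      using BJ DJ [OF w(1)] w(1) by (intro connected_Un) blast+
    then show ?thesis
      by (simp add: Int_Un_distrib2 Int_UN_distrib2)
  next
    case False
    have "?D z \<inter> slice_plane J = {}" if "z \<in> K" for z
    proof -
      have "m * norm (z - of_real (qre z)) \<le> dist z p" if p: "p \<in> slice_plane J" for p
      proof -
        have "m * norm (z - of_real (qre z)) \<le> dist z (slice_proj J z)"
          using False K(2) \<open>z \<in> K\<close>
          by (subst dist_slice_proj_slice [OF J I]) (auto simp: mult.commute intro: mult_right_mono)
        also have "\<dots> \<le> dist z p"
          by (rule dist_slice_proj_le [OF J p])
        finally show ?thesis .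
      qed
      then show ?thesis
        by fastforce
    qed
    then have "(?B \<union> (\<Union>z\<in>K. ?D z)) \<inter> slice_plane J = ?B \<inter> slice_plane J"
      by blast
    then show ?thesis
      using B J by (simp add: slice_domain_def)
  qed
  show ?thesis
    unfolding slice_domain_def quat_domain_def
  proof (intro conjI ballI conn slices)
    show "open (?B \<union> (\<Union>z\<in>K. ?D z))"
      by auto
    show "?B \<union> (\<Union>z\<in>K. ?D z) \<noteq> {}" "(?B \<union> (\<Union>z\<in>K. ?D z)) \<inter> \<real> \<noteq> {}"
      using B unfolding slice_domain_def by blast+
  qed
qed

section \<open>Paths to the real axis\<close>

text \<open>The set \<open>T\<close> of hitting times is compact, so there is a first one
  \<open>u\<close>; stopping shortly before \<open>u\<close> avoids \<open>S\<close> yet ends near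
  \<open>g u\<close>. The point \<open>r\<close> is fixed before \<open>\<rho>\<close> because the
  radius used later depends on it.\<close>

lemma path_first_hit:
  fixes g :: "real \<Rightarrow> 'a::metric_space"
  assumes g: "path g" and S: "closed S" "pathstart g \<notin> S" "pathfinish g \<in> S"
  obtains r where "r \<in> path_image g \<inter> S"
    "\<And>\<rho>. 0 < \<rho> \<Longrightarrow> \<exists>K. compact K \<and> connected K \<and> K \<subseteq> path_image g - S \<and>
      pathstart g \<in> K \<and> K \<inter> ball r \<rho> \<noteq> {}"
proof -
  have cont: "continuous_on {0..1} g"
    using g by (simp add: path_def)
  define T where "T = {t \<in> {0..1}. g t \<in> S}"
  have "closed T"
    unfolding T_def using continuous_closed_preimage [OF cont closed_atLeastAtMost S(1)]
    by (simp add: vimage_def Int_def)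
  moreover have "T \<subseteq> {0..1}"
    by (auto simp: T_def)
  ultimately have "compact T"
    by (metis compact_Int_closed compact_Icc inf.absorb2)
  moreover have "1 \<in> T"
    using S(3) by (simp add: T_def pathfinish_def)
  ultimately obtain u where u: "u \<in> T" "\<And>t. t \<in> T \<Longrightarrow> u \<le> t"
    using compact_attains_inf [of T] by blast
  have "u \<noteq> 0"
    using u(1) S(2) by (auto simp: T_def pathstart_def)
  then have u01: "0 < u" "u \<le> 1"
    using u(1) by (auto simp: T_def)
  show thesis
  proof
    show "g u \<in> path_image g \<inter> S"
      using u(1) by (auto simp: T_def path_image_def)
    fix \<rho> :: real
    assume "0 < \<rho>"
    then obtain d where d: "0 < d" "\<And>t. t \<in> {0..1} \<Longrightarrow> dist t u < d \<Longrightarrow> dist (g t) (g u) < \<rho>"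
      using cont u01 unfolding continuous_on_iff by (metis atLeastAtMost_iff less_imp_le)
    \<comment> \<open>The maximum keeps \<open>v\<close> in the unit interval; \<open>v < u\<close>
      still holds because \<open>u\<close> is positive.\<close>
    define v where "v = max 0 (u - d / 2)"
    have v: "0 \<le> v" "v < u" "dist v u < d"
      using d(1) u01 by (auto simp: v_def dist_real_def)
    have sub: "{0..v} \<subseteq> {0..1}"
      using v u01 by auto
    have "continuous_on {0..v} g"
      using cont sub by (rule continuous_on_subset)
    then have "compact (g ` {0..v})" "connected (g ` {0..v})"
      by (simp_all add: compact_continuous_image connected_continuous_image)
    moreover have "g ` {0..v} \<subseteq> path_image g - S"
    proof
      fix y
      assume "y \<in> g ` {0..v}"
      then obtain t where t: "t \<in> {0..v}" "y = g t"
        by blast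
      then have "t \<notin> T"
        using u(2) v(2) by force
      then show "y \<in> path_image g - S"
        using t sub by (auto simp: T_def path_image_def)
    qed
    moreover have "pathstart g \<in> g ` {0..v}"
      using v(1) by (simp add: pathstart_def)
    moreover have "g v \<in> g ` {0..v} \<inter> ball (g u) \<rho>"
      using d(2) [of v] v u01 by (simp add: dist_commute)
    ultimately show "\<exists>K. compact K \<and> connected K \<and> K \<subseteq> path_image g - S \<and>
        pathstart g \<in> K \<and> K \<inter> ball (g u) \<rho> \<noteq> {}"
      by blast
  qed
qed

lemma closed_Reals_quat: "closed (\<real> :: quat set)"
proof -
  have "(\<real> :: quat set) = span {1}"
    by (auto simp: Reals_def of_real_def span_singleton)
  then show ?thesis
    by (metis closed_span)
qed

text \<open>The trace of \<open>U\<close> on a half-plane through \<open>x\<close> is locally path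
  connected, so the component of \<open>x\<close>, which contains a real point, is a path
  component.\<close>

lemma speared_path_to_reals:
  assumes "speared U" "x \<in> U" "x \<notin> \<real>"
  obtains I g where "I \<in> imag_units" "path g" "path_image g \<subseteq> U \<inter> slice_plane I"
    "pathstart g = x" "pathfinish g \<in> \<real>"
proof -
  obtain I where I: "I \<in> imag_units" "x \<in> slice_halfplane I"
    using quat_in_slice_halfplane \<open>x \<notin> \<real>\<close> by blast
  define V where "V = U \<inter> slice_halfplane I"
  have "locally path_connected V"
    unfolding V_def
    by (rule locally_open_subset [OF convex_imp_locally_path_connected [OF convex_slice_halfplane]])
      (use assms(1) in \<open>auto simp: speared_def openin_open Int_commute\<close>)
  then have eq: "path_component_set V x = connected_component_set V x"
    by (rule path_component_eq_connected_component_set)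
  have "connected_component_set V x \<in> components V"
    using I assms by (auto simp: components_def V_def)
  then have "connected_component_set V x \<inter> \<real> \<noteq> {}"
    using assms(1) I(1) unfolding speared_def V_def by blast
  then obtain y where "y \<in> \<real>" "path_component V x y"
    unfolding eq [symmetric] by blast
  then obtain g where "path g" "path_image g \<subseteq> V" "pathstart g = x" "pathfinish g \<in> \<real>"
    unfolding path_component_def by metis
  then show thesis
    using that I(1) slice_halfplane_subset unfolding V_def by blast
qed

theorem proposition6p2:
  fixes U :: "quat set" and x\<^sub>0 :: quat
  assumes "speared U" and "x\<^sub>0 \<in> U"
  shows "\<exists>\<Lambda>. slice_domain \<Lambda> \<and> \<Lambda> \<subseteq> U \<and> x\<^sub>0 \<in> \<Lambda>"
proof -
  have "open U"
    using assms by (simp add: speared_def)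
  show ?thesis
  proof (cases "x\<^sub>0 \<in> \<real>")
    case True
    then obtain r where r: "x\<^sub>0 = of_real r"
      by (rule Reals_cases)
    obtain \<rho> where "0 < \<rho>" "ball x\<^sub>0 \<rho> \<subseteq> U"
      using \<open>open U\<close> assms(2) open_contains_ball by blast
    then show ?thesis
      using slice_domain_ball_of_real [of \<rho> r] r centre_in_ball by blast
  next
    case False
    obtain I g where I: "I \<in> imag_units" and g: "path g" "path_image g \<subseteq> U \<inter> slice_plane I"
      "pathstart g = x\<^sub>0" "pathfinish g \<in> \<real>"
      using speared_path_to_reals [OF assms False] .
    obtain r' where r': "r' \<in> path_image g \<inter> \<real>"
      and hit: "\<And>\<rho>. 0 < \<rho> \<Longrightarrow> \<exists>K. compact K \<and> connected K \<and> K \<subseteq> path_image g - \<real> \<and>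
        pathstart g \<in> K \<and> K \<inter> ball r' \<rho> \<noteq> {}"
      using path_first_hit [OF g(1) closed_Reals_quat _ g(4)] g(3) False by metis
    then obtain r where r: "r' = of_real r"
      by (metis IntD2 Reals_cases)
    obtain \<rho> where \<rho>: "0 < \<rho>" "ball r' \<rho> \<subseteq> U"
      using \<open>open U\<close> r' g(2) open_contains_ball by blast
    from hit [OF \<rho>(1)] obtain K w where K: "compact K" "connected K" "K \<subseteq> path_image g - \<real>"
      "x\<^sub>0 \<in> K" and w: "w \<in> K" "w \<in> ball r' \<rho>"
      unfolding g(3) by blast
    have "K \<subseteq> U"
      using K(3) g(2) by blast
    then obtain e where e: "0 < e" "(\<Union>z\<in>K. ball z e) \<subseteq> U"
      using compact_subset_open_imp_ball_epsilon_subset [OF K(1) \<open>open U\<close>] by blast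
    have "compact ((\<lambda>z. z - of_real (qre z)) ` K)"
    proof (rule compact_continuous_image [OF _ K(1)])
      \<comment> \<open>Written with an inner product, the imaginary part is covered by the standard
        continuity rules.\<close>
      have "z - of_real (qre z) = z - (z \<bullet> 1) *\<^sub>R 1" for z :: quat
        by (simp add: of_real_def inner_quat_def)
      then show "continuous_on K (\<lambda>z. z - of_real (qre z))"
        by (simp only:) (intro continuous_intros)
    qed
    then obtain M where M: "0 < M" "\<And>z. z \<in> K \<Longrightarrow> norm (z - of_real (qre z)) \<le> M"
      using compact_imp_bounded bounded_pos by (metis (no_types, lifting) imageI)
    \<comment> \<open>\<open>M\<close> bounds the imaginary parts on \<open>K\<close>, so every
      radius is at most \<open>m * M = e\<close>, the uniform margin of \<open>K\<close> in
      \<open>U\<close>.\<close>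
    define m where "m = e / M"
    have m: "0 < m"
      using e(1) M(1) by (simp add: m_def)
    define \<Lambda> where "\<Lambda> = ball (of_real r) \<rho> \<union> (\<Union>z\<in>K. ball z (m * norm (z - of_real (qre z))))"
    have "slice_domain \<Lambda>"
      unfolding \<Lambda>_def
      by (rule slice_domain_ball_tube [OF I K(2) _ _ w(1) _ m]) (use K(3) g(2) w r in auto)
    moreover have "\<Lambda> \<subseteq> U"
    proof -
      have "m * norm (z - of_real (qre z)) \<le> e" if "z \<in> K" for z
        using mult_left_mono [OF M(2) [OF that], of m] m M(1) by (simp add: m_def)
      then have "(\<Union>z\<in>K. ball z (m * norm (z - of_real (qre z)))) \<subseteq> (\<Union>z\<in>K. ball z e)"
        by (intro UN_mono subset_refl subset_ball)
      then show ?thesis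
        unfolding \<Lambda>_def using e(2) \<rho>(2) r by blast
    qed
    moreover have "x\<^sub>0 \<in> \<Lambda>"
    proof -
      \<comment> \<open>Since \<open>x\<^sub>0\<close> is not real, it is the centre of a nonempty
        ball of the tube.\<close>
      have "0 < norm (x\<^sub>0 - of_real (qre x\<^sub>0))"
        using False by (metis Reals_of_real right_minus_eq zero_less_norm_iff)
      then show ?thesis
        unfolding \<Lambda>_def using K(4) m by (intro UnI2 UN_I [of x\<^sub>0]) simp_all
    qed
    ultimately show ?thesis
      by blast
  qed
qed

end
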